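(* Let $A$ be a generalised Poisson affine space over $\Bbbk$. For $\lambda\in\Lambda(A)$ put $$Q_\lambda=\{ab^{-1}\mid a,b\in A_\lambda,\ b\neq 0\}\subseteq \operatorname{Frac}(A).$$ Then $$\operatorname{Cas}(\operatorname{Frac}(A))=\bigcup_{\lambda\in\Lambda(A)}Q_\lambda .$$ In other words, the Casimirs of $\operatorname{Frac}(A)$ are precisely the quotients of homogeneous elements of $A$ of the same weight.
   Context: $\Bbbk$ is a field of characteristic zero. A Poisson algebra over $\Bbbk$ is a commutative associative unital $\Bbbk$-algebra with a $\Bbbk$-bilinear Lie bracket $\{\cdot,\cdot\}$ that is a derivation in each argument. An element $a\in A$ is Poisson normal if $\{A,a\}\subseteq Aa$. A Poisson derivation of $A$ is a $\Bbbk$-linear map $\lambda:A\to A$ that is a derivation both of the associative product and of the bracket; $\operatorname{Der}_{\mathcal P}(A)$ is the set of these. If $A$ is a domain and $a\neq 0$ is Poisson normal, its weight is the unique Poisson derivation $\lambda$ with $\{b,a\}=\lambda(b)a$ for all $b\in A$. For $\lambda\in \operatorname{Der}_{\mathcal P}(A)$ put $A_\lambda=\{a\in A \mid \{b,a\}=\lambda(b)a \text{ for all } b\in A\}$ (elements of $A_\lambda$ are called homogeneous of weight $\lambda$), and let $\Lambda(A)=\{\lambda\in\operatorname{Der}_{\mathcal P}(A)\mid A_\lambda\neq 0\}$. A Poisson algebra $A$ is a generalised Poisson affine space if (i) $A$ is an integral domain generated as a $\Bbbk$-algebra by finitely many (nonzero) Poisson normal elements $x_1,\dots,x_n$ with weights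 $\lambda_1,\dots,\lambda_n$; and (ii) the weights pairwise commute: $\lambda_i\circ\lambda_j=\lambda_j\circ\lambda_i$ for all $i,j$. $\operatorname{Frac}(A)$ is the fraction field of $A$ with the unique Poisson bracket extending that of $A$, and $\operatorname{Cas}(B)$ denotes the Poisson centre of a Poisson algebra $B$, i.e. the elements (Casimirs) whose bracket with every element of $B$ is zero. *)

theory Defs
  imports "HOL-Computational_Algebra.Polynomial_Factorial"
begin

section \<open>Poisson algebras\<close>

locale poisson_algebra = vector_space scale
  for scale :: "'k::field_char_0 \<Rightarrow> 'a::comm_ring_1 \<Rightarrow> 'a" +
  fixes bracket :: "'a \<Rightarrow> 'a \<Rightarrow> 'a"
  assumes scale_mult: "scale k (a * b) = scale k a * b"
    and bracket_linear_left: "Vector_Spaces.linear scale scale (\<lambda>b. bracket b a)"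
    and bracket_linear_right: "Vector_Spaces.linear scale scale (\<lambda>b. bracket a b)"
    and bracket_self: "bracket a a = 0"
    and jacobi: "bracket a (bracket b c) + bracket b (bracket c a) + bracket c (bracket a b) = 0"
    and leibniz_left: "bracket (a * b) c = a * bracket b c + bracket a c * b"
    and leibniz_right: "bracket c (a * b) = a * bracket c b + bracket c a * b"

definition poisson_normal :: "('a::comm_ring_1 \<Rightarrow> 'a \<Rightarrow> 'a) \<Rightarrow> 'a \<Rightarrow> bool" where
  "poisson_normal bracket a \<longleftrightarrow> (\<forall>b. \<exists>c. bracket b a = c * a)"

definition poisson_derivation ::
  "('k::field_char_0 \<Rightarrow> 'a::comm_ring_1 \<Rightarrow> 'a) \<Rightarrow> ('a \<Rightarrow> 'a \<Rightarrow> 'a) \<Rightarrow> ('a \<Rightarrow> 'a) \<Rightarrow> bool" where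
  "poisson_derivation scale bracket d \<longleftrightarrow>
     Vector_Spaces.linear scale scale d \<and>
     (\<forall>a b. d (a * b) = a * d b + d a * b) \<and>
     (\<forall>a b. d (bracket a b) = bracket a (d b) + bracket (d a) b)"

text \<open>Meaningful for a nonzero Poisson normal element of a domain, see \<open>weight_unique\<close> below.\<close>

definition weight ::
  "('k::field_char_0 \<Rightarrow> 'a::idom \<Rightarrow> 'a) \<Rightarrow> ('a \<Rightarrow> 'a \<Rightarrow> 'a) \<Rightarrow> 'a \<Rightarrow> 'a \<Rightarrow> 'a" where
  "weight scale bracket a =
     (THE d. poisson_derivation scale bracket d \<and> (\<forall>b. bracket b a = d b * a))"

definition homogeneous :: "('a::comm_ring_1 \<Rightarrow> 'a \<Rightarrow> 'a) \<Rightarrow> ('a \<Rightarrow> 'a) \<Rightarrow> 'a set" where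
  "homogeneous bracket d = {a. \<forall>b. bracket b a = d b * a}"

definition weights ::
  "('k::field_char_0 \<Rightarrow> 'a::comm_ring_1 \<Rightarrow> 'a) \<Rightarrow> ('a \<Rightarrow> 'a \<Rightarrow> 'a) \<Rightarrow> ('a \<Rightarrow> 'a) set" where
  "weights scale bracket =
     {d. poisson_derivation scale bracket d \<and> homogeneous bracket d \<noteq> {0}}"

definition poisson_centre :: "('a::comm_ring_1 \<Rightarrow> 'a \<Rightarrow> 'a) \<Rightarrow> 'a set" where
  "poisson_centre bracket = {z. \<forall>w. bracket z w = 0}"

definition is_subalgebra :: "('k::field_char_0 \<Rightarrow> 'a::comm_ring_1 \<Rightarrow> 'a) \<Rightarrow> 'a set \<Rightarrow> bool" where
  "is_subalgebra scale S \<longleftrightarrow>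
     module.subspace scale S \<and> 1 \<in> S \<and> (\<forall>a\<in>S. \<forall>b\<in>S. a * b \<in> S)"

text \<open>
  That the algebra is an integral domain is expressed by the class of its type. The generators
  \<open>x\<^sub>1, \<dots>, x\<^sub>n\<close> enter only through the set \<open>X\<close> they form.
\<close>

locale generalised_poisson_affine_space = poisson_algebra scale bracket
  for scale :: "'k::field_char_0 \<Rightarrow> 'a::idom \<Rightarrow> 'a"
    and bracket :: "'a \<Rightarrow> 'a \<Rightarrow> 'a" +
  assumes normal_generators:
    "\<exists>X. finite X \<and> (\<forall>x\<in>X. x \<noteq> 0 \<and> poisson_normal bracket x) \<and>
         is_subalgebra scale hull X = UNIV \<and>
         (\<forall>x\<in>X. \<forall>y\<in>X. weight scale bracket x \<circ> weight scale bracket y =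
                          weight scale bracket y \<circ> weight scale bracket x)"

section \<open>The Poisson structure on the fraction field\<close>

definition frac_scale ::
  "('k::field_char_0 \<Rightarrow> 'a::idom \<Rightarrow> 'a) \<Rightarrow> 'k \<Rightarrow> 'a fract \<Rightarrow> 'a fract" where
  "frac_scale scale c q = to_fract (scale c 1) * q"

text \<open>Existence and uniqueness are shown in \<open>frac_bracket_unique\<close> below.\<close>

definition frac_bracket ::
  "('k::field_char_0 \<Rightarrow> 'a::idom \<Rightarrow> 'a) \<Rightarrow> ('a \<Rightarrow> 'a \<Rightarrow> 'a) \<Rightarrow> 'a fract \<Rightarrow> 'a fract \<Rightarrow> 'a fract" where
  "frac_bracket scale bracket =
     (THE B. poisson_algebra (frac_scale scale) B \<and>
             (\<forall>a b. B (to_fract a) (to_fract b) = to_fract (bracket a b)))"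

definition homogeneous_quotients :: "('a::idom \<Rightarrow> 'a \<Rightarrow> 'a) \<Rightarrow> ('a \<Rightarrow> 'a) \<Rightarrow> 'a fract set" where
  "homogeneous_quotients bracket d =
     {to_fract a * inverse (to_fract b) | a b.
        a \<in> homogeneous bracket d \<and> b \<in> homogeneous bracket d \<and> b \<noteq> 0}"

section \<open>Well-definedness of weights and of the bracket on the fraction field\<close>

context poisson_algebra
begin

lemma bracket_add_left: "bracket (a + b) c = bracket a c + bracket b c"
  and bracket_scale_left: "bracket (scale k a) c = scale k (bracket a c)"
  using bracket_linear_left[of c] by (simp_all add: linear_iff_module_hom module_hom_iff)

lemma bracket_add_right: "bracket c (a + b) = bracket c a + bracket c b"
  and bracket_scale_right: "bracket c (scale k a) = scale k (bracket c a)"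
  using bracket_linear_right[of c] by (simp_all add: linear_iff_module_hom module_hom_iff)

lemma bracket_0_left [simp]: "bracket 0 c = 0"
  using bracket_add_left[of 0 0 c] by simp

lemma bracket_0_right [simp]: "bracket c 0 = 0"
  using bracket_add_right[of c 0 0] by simp

lemma bracket_skew: "bracket a b = - bracket b a"
proof -
  have "bracket (a + b) (a + b) = bracket a b + bracket b a"
    unfolding bracket_add_left bracket_add_right by (simp add: bracket_self)
  then show ?thesis
    by (simp add: bracket_self eq_neg_iff_add_eq_0)
qed

lemma bracket_minus_right: "bracket a (- b) = - bracket a b"
  using bracket_add_right[of a b "- b"] by (simp add: eq_neg_iff_add_eq_0 add.commute)

lemma bracket_1_right [simp]: "bracket c 1 = 0"
  using leibniz_right[of c 1 1] by simp

lemma bracket_1_left [simp]: "bracket 1 c = 0"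
  using leibniz_left[of 1 1 c] by simp

end

lemma weight_unique:
  fixes scale :: "'k::field_char_0 \<Rightarrow> 'a::idom \<Rightarrow> 'a"
  assumes "poisson_algebra scale bracket" "poisson_normal bracket a" "a \<noteq> 0"
  shows "\<exists>!d. poisson_derivation scale bracket d \<and> (\<forall>b. bracket b a = d b * a)"
proof -
  interpret poisson_algebra scale bracket by fact
  from assms(2) obtain d where d: "\<And>b. bracket b a = d b * a"
    unfolding poisson_normal_def by metis
  have cancel: "x = y" if "x * a = y * a" for x y
    using that assms(3) by simp
  have "d (x + y) = d x + d y" for x y
    by (rule cancel) (simp add: d[symmetric] bracket_add_left distrib_right)
  moreover have "d (scale c x) = scale c (d x)" for c x
    by (rule cancel) (simp add: d[symmetric] bracket_scale_left scale_mult[symmetric])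
  ultimately have lin: "Vector_Spaces.linear scale scale d"
    using vector_space_axioms by (simp add: linear_iff_module_hom module_hom_iff module_iff_vector_space)
  have mult: "d (x * y) = x * d y + d x * y" for x y
  proof (rule cancel)
    have "d (x * y) * a = bracket (x * y) a" by (simp only: d)
    also have "\<dots> = x * (d y * a) + d x * a * y" by (simp add: leibniz_left flip: d)
    finally show "d (x * y) * a = (x * d y + d x * y) * a" by (simp add: algebra_simps)
  qed
  have br: "d (bracket x y) = bracket x (d y) + bracket (d x) y" for x y
  proof (rule cancel)
    have "bracket x (bracket y a) + bracket y (bracket a x) + bracket a (bracket x y) = 0"
      by (rule jacobi)
    moreover have "bracket a x = - bracket x a" "bracket a (bracket x y) = - bracket (bracket x y) a"
      by (rule bracket_skew)+
    ultimately have "bracket (bracket x y) a = bracket x (bracket y a) - bracket y (bracket x a)"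
      by (simp add: bracket_minus_right)
    also have "\<dots> = (d y * (d x * a) + bracket x (d y) * a) - (d x * (d y * a) + bracket y (d x) * a)"
      by (simp add: d leibniz_right)
    also have "\<dots> = (bracket x (d y) + bracket (d x) y) * a"
      by (simp add: algebra_simps bracket_skew[of y "d x"])
    finally show "d (bracket x y) * a = (bracket x (d y) + bracket (d x) y) * a" by (simp add: d)
  qed
  show ?thesis
  proof (rule ex1I[of _ d])
    show "poisson_derivation scale bracket d \<and> (\<forall>b. bracket b a = d b * a)"
      unfolding poisson_derivation_def using lin mult br d by blast
  next
    fix e assume "poisson_derivation scale bracket e \<and> (\<forall>b. bracket b a = e b * a)"
    then have "e b * a = d b * a" for b by (simp flip: d)
    then show "e = d" using assms(3) by auto
  qed
qed

lemma fract_eq_quotient: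
  obtains a b where "q = to_fract a / to_fract b" "b \<noteq> 0"
  by (cases q rule: Fract_cases_nonzero) (auto simp: Fract_conv_to_fract intro: that[of 0 1])

definition is_deriv_into_frac :: "('a::idom \<Rightarrow> 'a fract) \<Rightarrow> bool" where
  "is_deriv_into_frac D \<longleftrightarrow>
     (\<forall>a b. D (a + b) = D a + D b) \<and> (\<forall>a b. D (a * b) = to_fract a * D b + D a * to_fract b)"

definition is_deriv :: "('a::comm_ring_1 \<Rightarrow> 'a) \<Rightarrow> bool" where
  "is_deriv D \<longleftrightarrow> (\<forall>a b. D (a + b) = D a + D b) \<and> (\<forall>a b. D (a * b) = a * D b + D a * b)"

lemma is_deriv_eq_0:
  assumes "is_deriv D" "\<And>a. D (to_fract a) = 0"
  shows "D q = 0"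
proof -
  obtain a b where q: "q = to_fract a / to_fract b" "b \<noteq> 0" by (rule fract_eq_quotient)
  then have "to_fract a = to_fract b * q" by simp
  then have "0 = D (to_fract b * q)" using assms(2)[of a] by simp
  also have "\<dots> = to_fract b * D q" using assms by (simp add: is_deriv_def)
  finally show ?thesis using q(2) by simp
qed

lemma is_deriv_eqI:
  assumes "is_deriv D" "is_deriv E" "\<And>a. D (to_fract a) = E (to_fract a)"
  shows "D q = E q"
proof -
  have "is_deriv (\<lambda>q. D q - E q)"
    using assms(1,2) by (auto simp: is_deriv_def algebra_simps)
  from is_deriv_eq_0[OF this, of q] show ?thesis using assms(3) by simp
qed

text \<open>Quotient rule for a chosen representative; independent of the choice when \<open>D\<close> is a derivation.\<close>

definition extend_deriv :: "('a::idom \<Rightarrow> 'a fract) \<Rightarrow> 'a fract \<Rightarrow> 'a fract" where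
  "extend_deriv D q =
     (case (SOME (a, b). q = to_fract a / to_fract b \<and> b \<noteq> 0) of
        (a, b) \<Rightarrow> (D a * to_fract b - to_fract a * D b) / (to_fract b)\<^sup>2)"

lemma extend_deriv_quotient:
  assumes D: "is_deriv_into_frac D" and "b \<noteq> 0"
  shows "extend_deriv D (to_fract a / to_fract b) =
           (D a * to_fract b - to_fract a * D b) / (to_fract b)\<^sup>2"
proof -
  define P where "P = (\<lambda>(a', b'). to_fract a / to_fract b = to_fract a' / to_fract b' \<and> b' \<noteq> 0)"
  obtain c e where ce: "(SOME p. P p) = (c, e)" by fastforce
  have "P (a, b)" using assms by (simp add: P_def)
  then have "P (c, e)" unfolding ce[symmetric] by (rule someI)
  then have e: "e \<noteq> 0" and eq: "to_fract a / to_fract b = to_fract c / to_fract e"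
    by (auto simp: P_def)
  define A B C E where "A = to_fract a" and "B = to_fract b" and "C = to_fract c" and "E = to_fract e"
  have nz: "B \<noteq> 0" "E \<noteq> 0" using e assms(2) by (auto simp: B_def E_def)
  have x: "A * E = C * B"
    using eq nz by (simp add: A_def B_def C_def E_def field_simps)
  then have "to_fract (a * e) = to_fract (c * b)"
    by (simp add: A_def B_def C_def E_def)
  then have "D (a * e) = D (c * b)" by (simp del: to_fract_mult)
  then have y: "A * D e + D a * E = C * D b + D c * B"
    using D by (simp add: is_deriv_into_frac_def A_def B_def C_def E_def)
  define r where "r = A / B"
  have A: "A = r * B" and C: "C = r * E"
    using nz x by (auto simp: r_def field_simps)
  have z: "(D a - r * D b) * E = (D c - r * D e) * B"
    using y by (simp add: A C algebra_simps)
  have "(D c * E - C * D e) / E\<^sup>2 = (D c - r * D e) / E"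
    using nz by (simp add: C field_simps power2_eq_square)
  also have "\<dots> = (D a - r * D b) / B"
    using nz z by (simp add: frac_eq_eq)
  also have "\<dots> = (D a * B - A * D b) / B\<^sup>2"
    using nz by (simp add: A field_simps power2_eq_square)
  finally show ?thesis
    using ce by (simp add: extend_deriv_def P_def A_def B_def C_def E_def)
qed

lemma extend_deriv_to_fract:
  assumes "is_deriv_into_frac D"
  shows "extend_deriv D (to_fract a) = D a"
proof -
  have "D (1 * 1) = to_fract 1 * D 1 + D 1 * to_fract 1"
    using assms unfolding is_deriv_into_frac_def by blast
  then have "D 1 = D 1 + D 1" by (simp only: mult_1 mult_1_right to_fract_1)
  then have "D 1 = 0" by (simp only: add_cancel_right_right)
  then show ?thesis using extend_deriv_quotient[OF assms, of 1 a] by simp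
qed

lemma is_deriv_extend_deriv:
  assumes D: "is_deriv_into_frac D"
  shows "is_deriv (extend_deriv D)"
  unfolding is_deriv_def
proof safe
  fix p q :: "'a fract"
  obtain a b where p: "p = to_fract a / to_fract b" "b \<noteq> 0" by (rule fract_eq_quotient)
  obtain c e where q: "q = to_fract c / to_fract e" "e \<noteq> 0" by (rule fract_eq_quotient)
  have nz: "to_fract b \<noteq> 0" "to_fract e \<noteq> 0" "b * e \<noteq> 0" using p q by auto
  note ext = extend_deriv_quotient[OF D]
  have sum: "p + q = to_fract (a * e + c * b) / to_fract (b * e)"
    using p q by (simp add: field_simps)
  have prod: "p * q = to_fract (a * c) / to_fract (b * e)"
    using p q by simp
  show "extend_deriv D (p + q) = extend_deriv D p + extend_deriv D q"
    unfolding sum ext[OF nz(3)] unfolding p(1) q(1) ext[OF p(2)] ext[OF q(2)]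
    using D nz by (simp add: is_deriv_into_frac_def field_simps power2_eq_square)
  show "extend_deriv D (p * q) = p * extend_deriv D q + extend_deriv D p * q"
    unfolding prod ext[OF nz(3)] unfolding p(1) q(1) ext[OF p(2)] ext[OF q(2)]
    using D nz by (simp add: is_deriv_into_frac_def field_simps power2_eq_square)
qed

lemma frac_bracket_unique:
  fixes scale :: "'k::field_char_0 \<Rightarrow> 'a::idom \<Rightarrow> 'a"
  assumes "poisson_algebra scale bracket"
  shows "\<exists>!B. poisson_algebra (frac_scale scale) B \<and>
              (\<forall>a b. B (to_fract a) (to_fract b) = to_fract (bracket a b))"
proof -
  interpret poisson_algebra scale bracket by fact
  define E where "E = (\<lambda>c. extend_deriv (\<lambda>a. to_fract (bracket c a)))"
  have inner: "is_deriv_into_frac (\<lambda>a. to_fract (bracket c a))" for c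
    by (simp add: is_deriv_into_frac_def bracket_add_right leibniz_right)
  have E: "is_deriv (E c)" and E_emb: "E c (to_fract a) = to_fract (bracket c a)" for c a
    unfolding E_def using inner by (simp_all add: is_deriv_extend_deriv extend_deriv_to_fract)
  have E_add: "E (a + b) q = E a q + E b q" for a b q
  proof (rule is_deriv_eqI[where D = "E (a + b)"])
    show "is_deriv (\<lambda>q. E a q + E b q)"
      using E[of a] E[of b] by (auto simp: is_deriv_def algebra_simps)
  qed (simp_all add: E E_emb bracket_add_left)
  have E_mult: "E (a * b) q = to_fract a * E b q + E a q * to_fract b" for a b q
  proof (rule is_deriv_eqI[where D = "E (a * b)"])
    show "is_deriv (\<lambda>q. to_fract a * E b q + E a q * to_fract b)"
      using E[of a] E[of b] by (auto simp: is_deriv_def algebra_simps)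
  qed (simp_all add: E E_emb leibniz_left)
  define B where "B = (\<lambda>p q. extend_deriv (\<lambda>c. E c q) p)"
  have outer: "is_deriv_into_frac (\<lambda>c. E c q)" for q
    by (simp add: is_deriv_into_frac_def E_add E_mult)
  have Bl: "is_deriv (\<lambda>p. B p q)" and B_E: "B (to_fract c) q = E c q" for c q
    unfolding B_def using outer by (simp_all add: is_deriv_extend_deriv extend_deriv_to_fract)
  have B_emb: "B (to_fract a) (to_fract b) = to_fract (bracket a b)" for a b
    by (simp add: B_E E_emb)
  have add_l: "B (p + q) r = B p r + B q r" and mult_l: "B (p * q) r = p * B q r + B p r * q" for p q r
    using Bl[of r] by (auto simp: is_deriv_def)
  have add_r: "B r (p + q) = B r p + B r q" for p q r
  proof (rule is_deriv_eqI[where D = "\<lambda>r. B r (p + q)"])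
    show "is_deriv (\<lambda>r. B r p + B r q)"
      by (simp add: is_deriv_def add_l mult_l algebra_simps)
    show "B (to_fract a) (p + q) = B (to_fract a) p + B (to_fract a) q" for a
      using E[of a] by (simp add: B_E is_deriv_def)
  qed (rule Bl)
  have mult_r: "B r (p * q) = p * B r q + B r p * q" for p q r
  proof (rule is_deriv_eqI[where D = "\<lambda>r. B r (p * q)"])
    show "is_deriv (\<lambda>r. p * B r q + B r p * q)"
      by (simp add: is_deriv_def add_l mult_l algebra_simps)
    show "B (to_fract a) (p * q) = p * B (to_fract a) q + B (to_fract a) p * q" for a
      using E[of a] by (simp add: B_E is_deriv_def)
  qed (rule Bl)
  have skew: "B p q = - B q p" for p q
  proof (rule is_deriv_eqI[where D = "\<lambda>p. B p q"])
    show "is_deriv (\<lambda>p. - B q p)"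
      by (simp add: is_deriv_def add_r mult_r algebra_simps)
    show "B (to_fract a) q = - B q (to_fract a)" for a
    proof (rule is_deriv_eqI[where D = "B (to_fract a)"])
      show "is_deriv (B (to_fract a))" by (simp add: is_deriv_def add_r mult_r)
      show "is_deriv (\<lambda>q. - B q (to_fract a))"
        by (simp add: is_deriv_def add_l mult_l algebra_simps)
      show "B (to_fract a) (to_fract b) = - B (to_fract b) (to_fract a)" for b
        using bracket_skew[of a b] by (simp add: B_emb)
    qed
  qed (rule Bl)
  have self: "B p p = 0" for p
  proof -
    obtain a b where p: "p = to_fract a / to_fract b" "b \<noteq> 0" by (rule fract_eq_quotient)
    then have a: "to_fract a = to_fract b * p" and nz: "to_fract b \<noteq> 0" by simp_all
    have "0 = B (to_fract a) (to_fract a)" by (simp add: B_emb bracket_self)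
    also have "\<dots> = to_fract b * to_fract b * B p p +
        to_fract b * p * (B p (to_fract b) + B (to_fract b) p) + p * p * B (to_fract b) (to_fract b)"
      unfolding a by (simp add: mult_l mult_r algebra_simps)
    also have "\<dots> = to_fract b * to_fract b * B p p"
      using skew[of p "to_fract b"] by (simp add: B_emb bracket_self)
    finally show ?thesis using nz by simp
  qed
  have minus_r: "B r (- p) = - B r p" for r p
  proof -
    have "B r 0 = B r 0 + B r 0" using add_r[of r 0 0] by (simp only: add_0_left)
    then have "B r 0 = 0" by (simp only: add_cancel_right_right)
    then show ?thesis using add_r[of r p "- p"] by (simp add: eq_neg_iff_add_eq_0 add.commute)
  qed
  define J where "J = (\<lambda>p q r. B p (B q r) + B q (B r p) + B r (B p q))"
  have J_cyc: "J p q r = J q r p" for p q r by (simp add: J_def)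
  have J_deriv: "is_deriv (\<lambda>p. J p q r)" for q r
  proof -
    have "J (x + y) q r = J x q r + J y q r" for x y
      by (simp add: J_def add_l add_r)
    moreover have "J (x * y) q r = x * J y q r + J x q r * y" for x y
      using skew[of q x] skew[of q y] skew[of r x] skew[of r y]
      by (simp add: J_def mult_l mult_r add_r algebra_simps)
    ultimately show ?thesis by (simp add: is_deriv_def)
  qed
  have J0: "J p q r = 0" for p q r
  proof (rule is_deriv_eq_0[OF J_deriv])
    show "J (to_fract a) q r = 0" for a
      unfolding J_cyc[of "to_fract a"]
    proof (rule is_deriv_eq_0[OF J_deriv])
      show "J (to_fract b) r (to_fract a) = 0" for b
        unfolding J_cyc[of "to_fract b"]
      proof (rule is_deriv_eq_0[OF J_deriv])
        show "J (to_fract c) (to_fract a) (to_fract b) = 0" for c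
          unfolding J_def B_emb using jacobi[of c a b] by (simp flip: to_fract_add)
      qed
    qed
  qed
  have const: "B p (to_fract (scale k 1)) = 0" for k p
  proof (rule is_deriv_eq_0[OF Bl])
    show "B (to_fract a) (to_fract (scale k 1)) = 0" for a
      by (simp add: B_emb bracket_scale_right)
  qed
  have const': "B (to_fract (scale k 1)) p = 0" for k p
    using skew[of "to_fract (scale k 1)" p] by (simp add: const)
  have vs: "vector_space (frac_scale scale)"
  proof
    fix k l :: 'k and p q :: "'a fract"
    have "scale k (scale l 1) = scale k 1 * scale l 1"
      using scale_mult[of k 1 "scale l 1"] by simp
    then show "frac_scale scale k (frac_scale scale l p) = frac_scale scale (k * l) p"
      by (simp add: frac_scale_def mult.assoc flip: to_fract_mult)
  qed (simp_all add: frac_scale_def algebra_simps)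
  have ex: "poisson_algebra (frac_scale scale) B"
  proof -
    interpret F: vector_space "frac_scale scale" by (rule vs)
    show ?thesis
    proof
      fix c a b
      show "frac_scale scale c (a * b) = frac_scale scale c a * b"
        by (simp add: frac_scale_def mult.assoc)
    next
      fix p q r :: "'a fract"
      show "B p (B q r) + B q (B r p) + B r (B p q) = 0"
        using J0[of p q r] by (simp add: J_def)
    qed (simp_all add: frac_scale_def add_l add_r mult_l mult_r const const' self)
  qed
  show ?thesis
  proof (rule ex1I[of _ B])
    show "poisson_algebra (frac_scale scale) B \<and>
          (\<forall>a b. B (to_fract a) (to_fract b) = to_fract (bracket a b))"
      using ex B_emb by blast
  next
    fix C assume C: "poisson_algebra (frac_scale scale) C \<and>
      (\<forall>a b. C (to_fract a) (to_fract b) = to_fract (bracket a b))"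
    then interpret C: poisson_algebra "frac_scale scale" C by blast
    have "C p q = B p q" for p q
    proof (rule is_deriv_eqI[where D = "\<lambda>p. C p q"])
      show "is_deriv (\<lambda>p. C p q)"
        by (simp add: is_deriv_def C.bracket_add_left C.leibniz_left)
      show "C (to_fract a) q = B (to_fract a) q" for a
      proof (rule is_deriv_eqI[where D = "C (to_fract a)"])
        show "is_deriv (C (to_fract a))"
          by (simp add: is_deriv_def C.bracket_add_right C.leibniz_right)
        show "is_deriv (B (to_fract a))" by (simp add: is_deriv_def add_r mult_r)
        show "C (to_fract a) (to_fract b) = B (to_fract a) (to_fract b)" for b
          using C by (simp add: B_emb)
      qed
    qed (rule Bl)
    then show "C = B" by (intro ext)
  qed
qed

end

theory Submission
  imports Defs
begin

text \<open>
  Sums of the weights \<open>\<lambda>\<^sub>i\<close> form a commuting family \<open>M\<close> of Poisson derivations, and the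
  homogeneous elements with weights in \<open>M\<close> span \<open>A\<close>. Since the family commutes, each of its
  members preserves each \<open>A\<^sub>\<mu>\<close>.
  For a Casimir \<open>q\<close> the set \<open>I\<close> of all \<open>b\<close> with \<open>q b \<in> A\<close> is a nonzero Poisson ideal of \<open>A\<close>.
  Let \<open>b \<in> I\<close> be nonzero, with a minimal number of homogeneous summands, one of them of
  weight \<open>\<mu>\<close>. For homogeneous \<open>x\<close> the element \<open>{x, b} - \<mu>(x) b\<close> of \<open>I\<close> has fewer summands,
  hence is zero; so \<open>b\<close> is homogeneous of weight \<open>\<mu>\<close>, and then so is \<open>q b\<close>.
\<close>

text \<open>For \<open>W\<close> the weights of the generators, these are the weights of the
  monomials in them: \<open>zero\<close> belongs to 1 and \<open>add\<close> to products.\<close>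

inductive_set sum_closure :: "('b \<Rightarrow> 'a::monoid_add) set \<Rightarrow> ('b \<Rightarrow> 'a) set"
  for W :: "('b \<Rightarrow> 'a) set" where
  base: "d \<in> W \<Longrightarrow> d \<in> sum_closure W"
| zero: "(\<lambda>_. 0) \<in> sum_closure W"
| add: "d \<in> sum_closure W \<Longrightarrow> e \<in> sum_closure W \<Longrightarrow> (\<lambda>b. d b + e b) \<in> sum_closure W"

text \<open>Commuting with a fixed additive map passes to pointwise sums; this reduces first
  \<open>d\<close> and then \<open>e\<close> to members of \<open>W\<close>.\<close>

lemma sum_closure_commute:
  fixes W :: "('a::comm_monoid_add \<Rightarrow> 'a) set"
  assumes d: "d \<in> sum_closure W" and e: "e \<in> sum_closure W"
    and comm: "\<And>f g. f \<in> W \<Longrightarrow> g \<in> W \<Longrightarrow> f \<circ> g = g \<circ> f"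
    and add: "\<And>f a b. f \<in> sum_closure W \<Longrightarrow> f (a + b) = f a + f b"
    and zero: "\<And>f. f \<in> sum_closure W \<Longrightarrow> f 0 = 0"
  shows "d (e a) = e (d a)"
  using d
proof (induction arbitrary: a)
  case (base d)
  from e show ?case
  proof (induction arbitrary: a)
    case (base e)
    then show ?case using comm[OF \<open>d \<in> W\<close>] by (metis comp_apply)
  qed (simp_all add: add zero sum_closure.base[OF base])
qed (simp_all add: add[OF e] zero[OF e])

context poisson_algebra
begin

lemma bracket_diff_right: "bracket c (a - b) = bracket c a - bracket c b"
  using bracket_add_right[of c a "- b"] by (simp add: bracket_minus_right)

lemma poisson_derivationD:
  assumes "poisson_derivation scale bracket d"
  shows "d (a + b) = d a + d b"
    and "d (scale k a) = scale k (d a)"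
    and "d (a * b) = a * d b + d a * b"
    and "d (bracket a b) = bracket a (d b) + bracket (d a) b"
  using assms by (auto simp: poisson_derivation_def linear_iff_module_hom module_hom_iff)

lemma poisson_derivation_0 [simp]: "poisson_derivation scale bracket (\<lambda>_. 0)"
  using module_axioms
  by (simp add: poisson_derivation_def linear_iff_module_hom module_hom_iff
      module_iff_vector_space)

lemma poisson_derivation_add:
  assumes "poisson_derivation scale bracket d" "poisson_derivation scale bracket e"
  shows "poisson_derivation scale bracket (\<lambda>b. d b + e b)"
  using assms
  by (auto simp: poisson_derivation_def linear_iff_module_hom module_hom_iff scale_right_distrib
      bracket_add_left bracket_add_right algebra_simps)

lemma poisson_derivation_sum_closure:
  assumes "d \<in> sum_closure W" "\<And>d. d \<in> W \<Longrightarrow> poisson_derivation scale bracket d"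
  shows "poisson_derivation scale bracket d"
  using assms by induction (auto intro: poisson_derivation_add)

lemma homogeneous_1: "1 \<in> homogeneous bracket (\<lambda>_. 0)"
  by (simp add: homogeneous_def)

lemma homogeneous_mult:
  "a \<in> homogeneous bracket d \<Longrightarrow> b \<in> homogeneous bracket e \<Longrightarrow>
    a * b \<in> homogeneous bracket (\<lambda>x. d x + e x)"
  by (auto simp: homogeneous_def leibniz_right algebra_simps)

lemma homogeneous_diff:
  "a \<in> homogeneous bracket d \<Longrightarrow> b \<in> homogeneous bracket d \<Longrightarrow> a - b \<in> homogeneous bracket d"
  by (auto simp: homogeneous_def bracket_diff_right algebra_simps)

lemma homogeneous_scale:
  "a \<in> homogeneous bracket d \<Longrightarrow> scale k a \<in> homogeneous bracket d"
  by (auto simp: homogeneous_def bracket_scale_right scale_mult mult.commute[of "d _"])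

text \<open>Apply \<open>d\<close> to {b, x} = e(b) x and expand both sides. Commutation makes the
  surplus term on the right e(d b) x = {d b, x}, which cancels.\<close>

lemma homogeneous_commuting_derivation:
  assumes d: "poisson_derivation scale bracket d"
    and comm: "\<And>a. d (e a) = e (d a)"
    and x: "x \<in> homogeneous bracket e"
  shows "d x \<in> homogeneous bracket e"
  unfolding homogeneous_def
proof safe
  fix b
  have "bracket b (d x) + bracket (d b) x = d (bracket b x)"
    by (simp add: poisson_derivationD[OF d])
  also have "\<dots> = d (e b * x)" using x by (simp add: homogeneous_def)
  also have "\<dots> = e b * d x + e (d b) * x"
    by (simp add: poisson_derivationD[OF d] comm)
  also have "e (d b) * x = bracket (d b) x" using x by (simp add: homogeneous_def)
  finally show "bracket b (d x) = e b * d x" by simp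
qed

text \<open>The product is bilinear, so closure passes from \<open>H\<close> to its span in one
  factor at a time.\<close>

lemma span_multiplicative_subalgebra:
  assumes "1 \<in> H" and mult: "\<And>a b. a \<in> H \<Longrightarrow> b \<in> H \<Longrightarrow> a * b \<in> H"
  shows "is_subalgebra scale (span H)"
proof -
  have l: "a * b \<in> span H" if "a \<in> span H" "b \<in> H" for a b
    using that(1)
  proof (induction rule: span_induct_alt)
    case (step c x y)
    then show ?case using that(2) mult[of x b]
      by (auto simp: distrib_right scale_mult[symmetric] intro: span_add span_scale span_base)
  qed (simp add: span_zero)
  have "a * b \<in> span H" if "a \<in> span H" "b \<in> span H" for a b
    using that(2)
  proof (induction rule: span_induct_alt)
    case (step c x y)
    have "a * scale c x = scale c (a * x)"
      using scale_mult[of c x a] by (simp add: mult.commute)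
    then show ?case using step l[OF that(1), of x]
      by (auto simp: distrib_left intro: span_add span_scale)
  qed (simp add: span_zero)
  then show ?thesis
    using assms(1) by (auto simp: is_subalgebra_def span_base)
qed

end

text \<open>Collects what the ideal argument takes from the generators. \<open>add_closed\<close>
  reflects that weights add up when homogeneous elements are multiplied.\<close>

locale commuting_weights = poisson_algebra scale bracket
  for scale :: "'k::field_char_0 \<Rightarrow> 'a::comm_ring_1 \<Rightarrow> 'a"
    and bracket :: "'a \<Rightarrow> 'a \<Rightarrow> 'a" +
  fixes M :: "('a \<Rightarrow> 'a) set"
  assumes derivation: "d \<in> M \<Longrightarrow> poisson_derivation scale bracket d"
    and add_closed: "d \<in> M \<Longrightarrow> e \<in> M \<Longrightarrow> (\<lambda>b. d b + e b) \<in> M"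
    and commute: "d \<in> M \<Longrightarrow> e \<in> M \<Longrightarrow> d (e a) = e (d a)"
    and span_homogeneous: "span (\<Union>d\<in>M. homogeneous bracket d) = UNIV"
begin

text \<open>Summands may vanish or share a weight, so \<open>n\<close> only bounds the number of
  genuine components; such a bound suffices for induction on length.\<close>

inductive homogeneous_sum :: "nat \<Rightarrow> 'a \<Rightarrow> bool" where
  zero: "homogeneous_sum 0 0"
| step: "d \<in> M \<Longrightarrow> a \<in> homogeneous bracket d \<Longrightarrow> homogeneous_sum n b \<Longrightarrow>
    homogeneous_sum (Suc n) (a + b)"

lemma ex_homogeneous_sum: "\<exists>n. homogeneous_sum n b"
proof -
  have "b \<in> span (\<Union>d\<in>M. homogeneous bracket d)" by (simp add: span_homogeneous)
  then show ?thesis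
    by (induction rule: span_induct_alt)
      (auto intro: homogeneous_sum.intros homogeneous_scale)
qed

text \<open>On a summand of weight \<open>f\<close>, the map b -> {x, b} - d(x) b is multiplication
  by f(x) - d(x). By commutation this factor is homogeneous of weight \<open>e\<close>, so the
  product has weight e + f, again in \<open>M\<close>.\<close>

lemma homogeneous_sum_twisted_bracket:
  assumes "homogeneous_sum n b"
    and d: "d \<in> M" and e: "e \<in> M" and x: "x \<in> homogeneous bracket e"
  shows "homogeneous_sum n (bracket x b - d x * b)"
  using assms(1)
proof induction
  case zero
  then show ?case by (simp add: homogeneous_sum.zero)
next
  case (step f a n b)
  have "g x \<in> homogeneous bracket e" if "g \<in> M" for g
    by (rule homogeneous_commuting_derivation[OF derivation[OF that] commute[OF that e] x])
  then have "f x \<in> homogeneous bracket e" "d x \<in> homogeneous bracket e"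
    using d \<open>f \<in> M\<close> by blast+
  then have "(f x - d x) * a \<in> homogeneous bracket (\<lambda>b. e b + f b)"
    using step by (intro homogeneous_mult homogeneous_diff)
  moreover have "bracket x (a + b) - d x * (a + b) = (f x - d x) * a + (bracket x b - d x * b)"
    using step by (simp add: bracket_add_right homogeneous_def algebra_simps)
  ultimately show ?case
    using step e by (auto intro: homogeneous_sum.step add_closed)
qed

text \<open>The closure assumptions make \<open>I\<close> a Poisson ideal. Induction on the length
  of a sum for \<open>b\<close> replaces the choice of a minimal one: either \<open>b\<close> is
  already homogeneous, or a twisted bracket is a nonzero element of \<open>I\<close> with a shorter
  sum.\<close>

lemma poisson_ideal_homogeneous_element:
  assumes "b \<in> I" "b \<noteq> 0"
    and diff: "\<And>a b. a \<in> I \<Longrightarrow> b \<in> I \<Longrightarrow> a - b \<in> I"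
    and mult: "\<And>r a. a \<in> I \<Longrightarrow> r * a \<in> I"
    and bracket: "\<And>r a. a \<in> I \<Longrightarrow> bracket r a \<in> I"
  obtains c d where "c \<in> I" "c \<noteq> 0" "d \<in> M" "c \<in> homogeneous bracket d"
proof -
  obtain n where "homogeneous_sum n b" using ex_homogeneous_sum by blast
  then have "\<exists>c d. c \<in> I \<and> c \<noteq> 0 \<and> d \<in> M \<and> c \<in> homogeneous bracket d"
    using assms(1,2)
  proof (induction n arbitrary: b)
    case 0
    then show ?case by (auto elim: homogeneous_sum.cases)
  next
    case (Suc n)
    from Suc.prems(1) obtain d a b' where da: "d \<in> M" "a \<in> homogeneous bracket d"
      and b': "homogeneous_sum n b'" and b: "b = a + b'"
      by (auto elim: homogeneous_sum.cases)
    show ?case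
    proof (cases "\<forall>e\<in>M. \<forall>x\<in>homogeneous bracket e. bracket x b - d x * b = 0")
      case True
      \<comment> \<open>Both sides are linear in \<open>x\<close>, and the homogeneous elements
        span.\<close>
      have "bracket x b = d x * b" for x
      proof -
        have "x \<in> span (\<Union>e\<in>M. homogeneous bracket e)" by (simp add: span_homogeneous)
        then show ?thesis
        proof (induction rule: span_induct_alt)
          case base
          show ?case using poisson_derivationD(2)[OF derivation[OF da(1)], of 0 0] by simp
        next
          case (step c x y)
          then show ?case using True
            by (auto simp: poisson_derivationD[OF derivation[OF da(1)]] bracket_add_left
                bracket_scale_left scale_mult[symmetric] distrib_right)
        qed
      qed
      then show ?thesis using Suc.prems da(1) by (auto simp: homogeneous_def)
    next
      case False
      then obtain e x where e: "e \<in> M" "x \<in> homogeneous bracket e"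
        and nz: "bracket x b - d x * b \<noteq> 0" by blast
      \<comment> \<open>The summand \<open>a\<close> has weight \<open>d\<close> and is annihilated,
        so only \<open>b'\<close> contributes and the length drops by one.\<close>
      have "bracket x b - d x * b = bracket x b' - d x * b'"
        using da by (simp add: b bracket_add_right homogeneous_def algebra_simps)
      then have "homogeneous_sum n (bracket x b - d x * b)"
        using homogeneous_sum_twisted_bracket[OF b' da(1) e] by simp
      then show ?thesis
        using Suc.IH nz Suc.prems(2) by (blast intro: diff mult bracket)
    qed
  qed
  then show ?thesis using that by blast
qed

end

text \<open>Take for \<open>M\<close> all sums of generator weights. The span of the homogeneous
  elements is then a subalgebra containing the generators, hence everything.\<close>

lemma (in generalised_poisson_affine_space) ex_commuting_weights:
  obtains M where "commuting_weights scale bracket M"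
proof -
  obtain X where *: "finite X \<and> (\<forall>x\<in>X. x \<noteq> 0 \<and> poisson_normal bracket x) \<and>
      is_subalgebra scale hull X = UNIV \<and>
      (\<forall>x\<in>X. \<forall>y\<in>X. weight scale bracket x \<circ> weight scale bracket y =
        weight scale bracket y \<circ> weight scale bracket x)"
    using normal_generators by (rule exE)
  note X = *[THEN conjunct2, THEN conjunct1]
    and gen = *[THEN conjunct2, THEN conjunct2, THEN conjunct1]
    and comm = *[THEN conjunct2, THEN conjunct2, THEN conjunct2]
  have w: "poisson_derivation scale bracket (weight scale bracket x)"
    "x \<in> homogeneous bracket (weight scale bracket x)" if "x \<in> X" for x
  proof -
    have "x \<noteq> 0" "poisson_normal bracket x" using X that by blast+
    note theI'[OF weight_unique[OF poisson_algebra_axioms this(2,1)]]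
    then have "poisson_derivation scale bracket (weight scale bracket x) \<and>
        (\<forall>b. bracket b x = weight scale bracket x b * x)"
      by (fold weight_def)
    then show "poisson_derivation scale bracket (weight scale bracket x)"
      "x \<in> homogeneous bracket (weight scale bracket x)" by (simp_all add: homogeneous_def)
  qed
  define M where "M = sum_closure (weight scale bracket ` X)"
  define H where "H = (\<Union>d\<in>M. homogeneous bracket d)"
  have der: "poisson_derivation scale bracket d" if "d \<in> M" for d
    using that w by (auto simp: M_def intro: poisson_derivation_sum_closure)
  have zero: "d 0 = 0" if "d \<in> M" for d
    using poisson_derivationD(2)[OF der[OF that], of 0 0] by simp
  have "is_subalgebra scale (span H)"
  proof (rule span_multiplicative_subalgebra)
    show "1 \<in> H" using homogeneous_1 by (auto simp: H_def M_def intro: sum_closure.zero)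
    show "a * b \<in> H" if "a \<in> H" "b \<in> H" for a b
      using that by (auto simp: H_def M_def intro: sum_closure.add homogeneous_mult)
  qed
  moreover have "X \<subseteq> span H"
    using w by (auto simp: H_def M_def intro!: span_base sum_closure.base)
  ultimately have "is_subalgebra scale hull X \<subseteq> span H" by (intro hull_minimal)
  then have span: "span H = UNIV" using gen by auto
  have "commuting_weights scale bracket M"
  proof
    fix d e a assume "d \<in> M" "e \<in> M"
    then show "d (e a) = e (d a)"
      unfolding M_def
    proof (rule sum_closure_commute)
      show "f \<circ> g = g \<circ> f"
        if "f \<in> weight scale bracket ` X" "g \<in> weight scale bracket ` X" for f g
        using that comm by blast
    qed (simp_all add: zero poisson_derivationD(1)[OF der] flip: M_def)
  qed (use der span in \<open>auto simp: H_def M_def intro: sum_closure.add\<close>)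
  then show ?thesis using that by blast
qed

theorem proposition3p9:
  fixes scale :: "'k::field_char_0 \<Rightarrow> 'a::idom \<Rightarrow> 'a"
    and bracket :: "'a \<Rightarrow> 'a \<Rightarrow> 'a"
  assumes "generalised_poisson_affine_space scale bracket"
  shows "poisson_centre (frac_bracket scale bracket) =
           (\<Union>d\<in>weights scale bracket. homogeneous_quotients bracket d)"
proof -
  interpret generalised_poisson_affine_space scale bracket by fact
  define B where "B = frac_bracket scale bracket"
  have "poisson_algebra (frac_scale scale) B"
    and B: "\<And>a b. B (to_fract a) (to_fract b) = to_fract (bracket a b)"
    using theI'[OF frac_bracket_unique[OF poisson_algebra_axioms]]
    by (auto simp: B_def frac_bracket_def)
  then interpret F: poisson_algebra "frac_scale scale" B by blast
  obtain M where "commuting_weights scale bracket M" by (rule ex_commuting_weights)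
  then interpret commuting_weights scale bracket M .
  have "q \<in> (\<Union>d\<in>weights scale bracket. homogeneous_quotients bracket d)"
    if "q \<in> poisson_centre B" for q
  proof -
    have q: "B w q = 0" for w
      using that F.bracket_skew[of w q] by (simp add: poisson_centre_def)
    \<comment> \<open>Multiplication by a Casimir commutes with every {w, _}. This makes
      \<open>I\<close> stable under brackets and carries the weight of \<open>c\<close> over to q
      c.\<close>
    have Bq: "B w (q * r) = q * B w r" for w r
      by (simp add: F.leibniz_right q)
    define I where "I = {b. \<exists>a. q * to_fract b = to_fract a}"
    obtain a b where "q = to_fract a / to_fract b" "b \<noteq> 0" by (rule fract_eq_quotient)
    \<comment> \<open>Any denominator of \<open>q\<close> lies in \<open>I\<close>, so this ideal is
      nonzero.\<close>
    then have "b \<in> I" "b \<noteq> 0" by (auto simp: I_def)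
    then obtain c d where "c \<in> I" and c: "c \<noteq> 0" "d \<in> M" "c \<in> homogeneous bracket d"
    proof (rule poisson_ideal_homogeneous_element)
      fix b b' assume "b \<in> I" "b' \<in> I"
      then obtain a a' where "q * to_fract b = to_fract a" "q * to_fract b' = to_fract a'"
        by (auto simp: I_def)
      then have "q * to_fract (b - b') = to_fract (a - a')" by (simp add: right_diff_distrib)
      then show "b - b' \<in> I" by (auto simp: I_def simp del: to_fract_diff)
    next
      fix r b assume "b \<in> I"
      then obtain a where a: "q * to_fract b = to_fract a" by (auto simp: I_def)
      then have "q * to_fract (r * b) = to_fract (r * a)" by (simp add: mult.left_commute[of q])
      then show "r * b \<in> I" by (auto simp: I_def simp del: to_fract_mult)
      have "q * to_fract (bracket r b) = to_fract (bracket r a)" by (simp add: Bq flip: a B)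
      then show "bracket r b \<in> I" by (auto simp: I_def)
    qed
    then obtain a where a: "q * to_fract c = to_fract a" by (auto simp: I_def)
    \<comment> \<open>The weight equation for a = q c is checked in the fraction field and pulled
      back along the injective \<open>to_fract\<close>.\<close>
    have "to_fract (bracket w a) = to_fract (d w * a)" for w
    proof -
      have "to_fract (bracket w a) = q * to_fract (bracket w c)"
        by (simp add: Bq flip: a B)
      also have "\<dots> = to_fract (d w) * (q * to_fract c)"
        using c(3) by (simp add: homogeneous_def)
      finally show ?thesis by (simp add: a)
    qed
    then have "a \<in> homogeneous bracket d" by (simp add: homogeneous_def del: to_fract_mult)
    moreover have "q = to_fract a * inverse (to_fract c)"
      using c(1) by (simp flip: a)
    ultimately have "q \<in> homogeneous_quotients bracket d"
      using c by (auto simp: homogeneous_quotients_def)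
    moreover have "d \<in> weights scale bracket"
      using c derivation by (auto simp: weights_def)
    ultimately show ?thesis by blast
  qed
  moreover have "q \<in> poisson_centre B" if "q \<in> homogeneous_quotients bracket d" for q d
  proof -
    from that obtain a b where q: "q = to_fract a * inverse (to_fract b)"
      and ab: "a \<in> homogeneous bracket d" "b \<in> homogeneous bracket d" and "b \<noteq> 0"
      by (auto simp: homogeneous_quotients_def)
    \<comment> \<open>In product form the Leibniz rule applies without brackets of inverses.\<close>
    then have a: "to_fract a = to_fract b * q" by simp
    \<comment> \<open>A derivation of the fraction field that vanishes on \<open>A\<close> is zero,
      so brackets with elements of \<open>A\<close> suffice.\<close>
    have "is_deriv (\<lambda>w. B w q)"
      by (simp add: is_deriv_def F.bracket_add_left F.leibniz_left)
    moreover have "B (to_fract w) q = 0" for w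
    proof -
      have "to_fract (d w * a) = B (to_fract w) (to_fract a)"
        using ab by (simp add: B homogeneous_def)
      also have "\<dots> = to_fract b * B (to_fract w) q + to_fract (d w * b) * q"
        using ab by (simp add: a F.leibniz_right B homogeneous_def)
      \<comment> \<open>This term equals the left-hand side of the chain, which leaves b {w, q} =
        0.\<close>
      also have "to_fract (d w * b) * q = to_fract (d w * a)" by (simp add: a)
      finally show ?thesis using \<open>b \<noteq> 0\<close> by simp
    qed
    ultimately have "B w q = 0" for w by (rule is_deriv_eq_0)
    then show ?thesis using F.bracket_skew[of q] by (simp add: poisson_centre_def)
  qed
  ultimately show ?thesis unfolding B_def by blast
qed

end
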